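(* Let $X$ be a simplicial complex on vertex set $V$. Let $U\subset V$ be such that $U\notin X$ and every missing face $\tau$ of $X$ satisfies $|\tau\setminus U|\leq 1$. Then $X$ is $(|U|-1)$-representable.
   Context: A missing face of $X$ is a set $\tau\subset V$ with $\tau\notin X$ but $\sigma\in X$ for all $\sigma\subsetneq\tau$. $X$ is $d$-representable if it is isomorphic to the nerve $\{\sigma\subset V:\bigcap_{v\in\sigma}C_v\neq\emptyset\}$ of a family $\{C_v\}_{v\in V}$ of compact convex sets in $\mathbb{R}^d$. *)

theory Defs
  imports "HOL-Analysis.Abstract_Euclidean_Space"
begin

text \<open>Vertices of \<open>V\<close> need not be faces: a singleton may be a missing face. The empty
  set is always a face.\<close>

definition abstract_simplicial_complex :: "'a set \<Rightarrow> 'a set set \<Rightarrow> bool"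
  where "abstract_simplicial_complex V X \<longleftrightarrow>
    X \<subseteq> Pow V \<and> {} \<in> X \<and> (\<forall>\<sigma>\<in>X. \<forall>\<rho>. \<rho> \<subseteq> \<sigma> \<longrightarrow> \<rho> \<in> X)"

definition missing_face :: "'a set \<Rightarrow> 'a set set \<Rightarrow> 'a set \<Rightarrow> bool"
  where "missing_face V X \<tau> \<longleftrightarrow> \<tau> \<subseteq> V \<and> \<tau> \<notin> X \<and> (\<forall>\<sigma>. \<sigma> \<subset> \<tau> \<longrightarrow> \<sigma> \<in> X)"

definition isomorphic_complexes ::
    "'a set \<Rightarrow> 'a set set \<Rightarrow> 'b set \<Rightarrow> 'b set set \<Rightarrow> bool"
  where "isomorphic_complexes V X W Y \<longleftrightarrow>
    (\<exists>f. bij_betw f V W \<and> (\<forall>\<sigma>. \<sigma> \<subseteq> V \<longrightarrow> (\<sigma> \<in> X \<longleftrightarrow> f ` \<sigma> \<in> Y)))"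

text \<open>The empty set belongs to the nerve, since the empty intersection is \<open>UNIV\<close>.\<close>

definition nerve :: "'a set \<Rightarrow> ('a \<Rightarrow> 'p set) \<Rightarrow> 'a set set"
  where "nerve V C = {\<sigma>. \<sigma> \<subseteq> V \<and> (\<Inter>v\<in>\<sigma>. C v) \<noteq> {}}"

text \<open>The space \<open>\<real>\<^sup>d\<close> is \<^const>\<open>Euclidean_space\<close> \<open>d\<close>, whose points are the sequences
  vanishing from index \<open>d\<close> on (a single point if \<open>d = 0\<close>). The function type is not an
  instance of \<^class>\<open>real_vector\<close>, so convexity is written out coordinatewise.\<close>

definition convex_seqs :: "(nat \<Rightarrow> real) set \<Rightarrow> bool"
  where "convex_seqs S \<longleftrightarrow>
    (\<forall>x\<in>S. \<forall>y\<in>S. \<forall>u\<ge>0. \<forall>v\<ge>0. u + v = 1 \<longrightarrow> (\<lambda>i. u * x i + v * y i) \<in> S)"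

text \<open>The sets \<open>C v\<close> may be empty; \<^const>\<open>compactin\<close> includes \<open>C v \<subseteq> \<real>\<^sup>d\<close>.\<close>

definition representable :: "nat \<Rightarrow> 'a set \<Rightarrow> 'a set set \<Rightarrow> bool"
  where "representable d V X \<longleftrightarrow>
    (\<exists>C :: 'a \<Rightarrow> (nat \<Rightarrow> real) set.
      (\<forall>v\<in>V. compactin (Euclidean_space d) (C v) \<and> convex_seqs (C v)) \<and>
      isomorphic_complexes V X V (nerve V C))"

end

theory Submission
  imports Defs
begin

text \<open>Identify \<open>U\<close> with the vertices of a simplex of dimension \<open>card U - 1\<close> and let \<open>Z x\<close> be the
  set of vertices at which the barycentric coordinate of \<open>x\<close> vanishes. For each vertex \<open>v\<close>, the
  points \<open>x\<close> of the simplex with \<open>Z x \<union> {v} \<in> X\<close> and, if \<open>v \<in> U\<close>, also \<open>v \<in> Z x\<close>, form a convex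
  set, because \<open>X\<close> is closed under subsets; to make it compact, the condition that no \<open>\<tau> \<subseteq> U\<close> with
  \<open>\<tau> \<union> {v} \<notin> X\<close> lies in \<open>Z x\<close> is strengthened to a total coordinate weight of at least
  \<open>1 / card U\<close> on \<open>\<tau>\<close>. A face \<open>\<sigma>\<close> yields a common point of its sets, namely the barycentre of the
  simplex face spanned by \<open>U - \<sigma>\<close>. Conversely, a point \<open>x\<close> common to the sets of \<open>\<sigma>\<close> has
  \<open>(\<sigma> \<inter> U) \<union> {v} \<subseteq> Z x \<union> {v} \<in> X\<close> for all \<open>v \<in> \<sigma>\<close>, which covers every potential missing face
  inside \<open>\<sigma>\<close>.\<close>

text \<open>The standard simplex with vertices indexed by \<open>{..d}\<close> is placed in
  \<open>d\<close>-space by dropping its last coordinate, which is recovered at index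
  \<open>d\<close> from the total 1.\<close>

definition barycentric :: "nat \<Rightarrow> (nat \<Rightarrow> real) \<Rightarrow> nat \<Rightarrow> real"
  where "barycentric d x i = (if i < d then x i else 1 - (\<Sum>j<d. x j))"

lemma barycentric_convex_combination:
  assumes "u + v = 1"
  shows "barycentric d (\<lambda>i. u * x i + v * y i) i = u * barycentric d x i + v * barycentric d y i"
proof -
  \<comment> \<open>The constant 1 in the last coordinate splits as \<open>u + v\<close>.\<close>
  have "u + v - (\<Sum>j<d. u * x j + v * y j) = u * (1 - (\<Sum>j<d. x j)) + v * (1 - (\<Sum>j<d. y j))"
    by (simp add: sum.distrib sum_distrib_left algebra_simps)
  then show ?thesis
    using assms by (simp add: barycentric_def)
qed

lemma continuous_on_barycentric: "continuous_on S (\<lambda>x. barycentric d x i)"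
proof -
  have "continuous_on S (\<lambda>x :: nat \<Rightarrow> real. x j)" for j
    by (rule continuous_on_subset[OF continuous_on_product_coordinates]) simp
  then show ?thesis
    unfolding barycentric_def by (cases "i < d") (auto intro!: continuous_intros)
qed

lemma barycentric_surj:
  assumes "(\<Sum>i\<le>d. y i) = 1"
  obtains x where "\<And>i. i \<ge> d \<Longrightarrow> x i = 0" "\<And>i. i \<le> d \<Longrightarrow> barycentric d x i = y i"
proof
  let ?x = "\<lambda>i. if i < d then y i else 0"
  show "barycentric d ?x i = y i" if "i \<le> d" for i
  proof -
    have "y d = 1 - (\<Sum>j<d. y j)"
      using assms by (simp flip: lessThan_Suc_atMost)
    with that show ?thesis
      by (auto simp: barycentric_def not_less)
  qed
qed auto

definition closed_simplex :: "nat \<Rightarrow> (nat \<Rightarrow> real) set"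
  where "closed_simplex d = {x. (\<forall>i\<ge>d. x i = 0) \<and> (\<forall>i\<le>d. 0 \<le> barycentric d x i)}"

text \<open>The simplex is a closed subset of the cube of all sequences in \<open>{0..1}\<close>,
  which is compact by Tychonoff's theorem.\<close>

lemma compact_closed_simplex: "compact (closed_simplex d)"
proof (rule compact_Int_closed[of "PiE UNIV (\<lambda>_. {0..1::real})" "closed_simplex d", THEN back_subst[of compact]])
  show "compact (PiE UNIV (\<lambda>_::nat. {0..1::real}))"
    unfolding compactin_euclidean_iff[symmetric] euclidean_product_topology[symmetric] compactin_PiE
    by simp
  have "closed_simplex d = (\<Inter>i\<in>{d..}. {x. x i = 0}) \<inter> (\<Inter>i\<in>{..d}. {x. 0 \<le> barycentric d x i})"
    by (auto simp: closed_simplex_def)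
  also have "closed \<dots>"
    by (intro closed_Int closed_INT ballI closed_Collect_le closed_Collect_eq
        continuous_on_barycentric continuous_on_product_coordinates continuous_on_const)
  finally show "closed (closed_simplex d)" .
  have "x i \<in> {0..1}" if "x \<in> closed_simplex d" for x i
  proof (cases "i < d")
    case True
    have nn: "0 \<le> x j" if "j < d" for j
      using \<open>x \<in> closed_simplex d\<close> that
      by (auto simp: closed_simplex_def barycentric_def dest!: spec[of _ j])
    have "0 \<le> barycentric d x d"
      using that by (simp add: closed_simplex_def)
    then have "(\<Sum>j<d. x j) \<le> 1"
      by (simp add: barycentric_def)
    moreover have "x i \<le> (\<Sum>j<d. x j)"
      using True nn by (intro member_le_sum) auto
    ultimately show ?thesis
      using nn True by auto
  next
    case False
    then show ?thesis using that by (simp add: closed_simplex_def)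
  qed
  then show "PiE UNIV (\<lambda>_. {0..1}) \<inter> closed_simplex d = closed_simplex d"
    by (auto simp: PiE_def Pi_def)
qed

lemma subset_missing_face:
  assumes "finite \<sigma>" "\<sigma> \<subseteq> V" "\<sigma> \<notin> X"
  obtains \<tau> where "\<tau> \<subseteq> \<sigma>" "missing_face V X \<tau>"
proof -
  have "finite (Pow \<sigma> - X)" "Pow \<sigma> - X \<noteq> {}"
    using assms by auto
  then obtain \<tau> where \<tau>: "\<tau> \<in> Pow \<sigma> - X"
      "\<forall>\<rho>\<in>Pow \<sigma> - X. \<rho> \<subseteq> \<tau> \<longrightarrow> \<tau> = \<rho>"
    by (meson finite_has_minimal)
  then have "\<rho> \<in> X" if "\<rho> \<subset> \<tau>" for \<rho>
    using that by blast
  with \<tau> \<open>\<sigma> \<subseteq> V\<close> show thesis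
    by (intro that[of \<tau>]) (auto simp: missing_face_def)
qed

text \<open>The map \<open>e\<close> numbers the vertices in \<open>U\<close> by the coordinates of
  the simplex. For finite nonempty \<open>U\<close> the threshold \<open>1 / card U\<close> is
  positive, so no constrained \<open>\<tau>\<close> consists of zeros only; yet it does not exceed
  \<open>1 / card W\<close>, the weight of each vertex in the barycentre of the face spanned by a
  nonempty \<open>W \<subseteq> U\<close>.\<close>

definition vertex_body :: "'a set set \<Rightarrow> 'a set \<Rightarrow> ('a \<Rightarrow> nat) \<Rightarrow> 'a \<Rightarrow> (nat \<Rightarrow> real) set"
  where "vertex_body X U e v = {x \<in> closed_simplex (card U - 1).
    (v \<in> U \<longrightarrow> barycentric (card U - 1) x (e v) = 0) \<and>
    (\<forall>\<tau>\<subseteq>U. insert v \<tau> \<notin> X \<longrightarrow> 1 / card U \<le> (\<Sum>u\<in>\<tau>. barycentric (card U - 1) x (e u)))}"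

lemma compactin_vertex_body:
  "compactin (Euclidean_space (card U - 1)) (vertex_body X U e v)"
proof -
  let ?d = "card U - 1"
  \<comment> \<open>Indexing by \<open>{v} \<inter> U\<close> drops the equation when
    \<open>v\<close> lies outside \<open>U\<close>.\<close>
  have "vertex_body X U e v = closed_simplex ?d
      \<inter> ((\<Inter>w\<in>{v} \<inter> U. {x. barycentric ?d x (e w) = 0})
      \<inter> (\<Inter>\<tau>\<in>{\<tau>. \<tau> \<subseteq> U \<and> insert v \<tau> \<notin> X}. {x. 1 / card U \<le> (\<Sum>u\<in>\<tau>. barycentric ?d x (e u))}))"
    by (auto simp: vertex_body_def)
  also have "compact \<dots>"
    by (intro compact_Int_closed compact_closed_simplex closed_Int closed_INT ballI
        closed_Collect_le closed_Collect_eq continuous_on_sum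
        continuous_on_barycentric continuous_on_const)
  finally have "compact (vertex_body X U e v)" .
  then show ?thesis
    by (auto simp: Euclidean_space_def compactin_subtopology euclidean_product_topology
        vertex_body_def closed_simplex_def)
qed

lemma convex_seqs_vertex_body: "convex_seqs (vertex_body X U e v)"
  unfolding convex_seqs_def
proof (intro ballI allI impI)
  fix x y :: "nat \<Rightarrow> real" and s t :: real
  let ?d = "card U - 1" and ?z = "\<lambda>i. s * x i + t * y i"
  assume x: "x \<in> vertex_body X U e v" and y: "y \<in> vertex_body X U e v"
    and st: "0 \<le> s" "0 \<le> t" "s + t = 1"
  have z: "barycentric ?d ?z i = s * barycentric ?d x i + t * barycentric ?d y i" for i
    using st by (simp add: barycentric_convex_combination)
  have "1 / card U \<le> (\<Sum>u\<in>\<tau>. barycentric ?d ?z (e u))"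
    if "\<tau> \<subseteq> U" "insert v \<tau> \<notin> X" for \<tau>
  proof -
    have "s * (1 / card U) + t * (1 / card U)
        \<le> s * (\<Sum>u\<in>\<tau>. barycentric ?d x (e u)) + t * (\<Sum>u\<in>\<tau>. barycentric ?d y (e u))"
      using x y st that by (intro add_mono mult_left_mono) (auto simp: vertex_body_def)
    then show ?thesis
      using st by (simp add: z sum.distrib sum_distrib_left del: One_nat_def
          flip: distrib_right add_divide_distrib)
  qed
  then show "?z \<in> vertex_body X U e v"
    using x y st by (auto simp: vertex_body_def closed_simplex_def z simp del: One_nat_def)
qed

text \<open>Otherwise the zero set would itself be one of the constrained \<open>\<tau>\<close>, but
  its weight is 0.\<close>

lemma vertex_body_zeros:
  assumes "finite U" "U \<noteq> {}" "x \<in> vertex_body X U e v"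
  shows "insert v {u \<in> U. barycentric (card U - 1) x (e u) = 0} \<in> X"
proof (rule ccontr)
  let ?Z = "{u \<in> U. barycentric (card U - 1) x (e u) = 0}"
  assume "insert v ?Z \<notin> X"
  moreover have "1 / card U \<le> (\<Sum>u\<in>\<tau>. barycentric (card U - 1) x (e u))"
    if "\<tau> \<subseteq> U" "insert v \<tau> \<notin> X" for \<tau>
    using assms(3) that by (simp add: vertex_body_def)
  ultimately have "1 / card U \<le> (\<Sum>u\<in>?Z. barycentric (card U - 1) x (e u))"
    by (metis (no_types, lifting) mem_Collect_eq subsetI)
  also have "\<dots> = 0"
    by simp
  finally show False
    using assms by (simp add: card_gt_0_iff)
qed

lemma vertex_bodies_common_point:
  assumes "abstract_simplicial_complex V X" "finite U" "U \<notin> X"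
    and e: "bij_betw e U {..card U - 1}" and "\<sigma> \<in> X"
  shows "(\<Inter>v\<in>\<sigma>. vertex_body X U e v) \<noteq> {}"
proof -
  let ?d = "card U - 1" and ?W = "U - \<sigma>"
  have down: "\<rho> \<in> X" if "\<rho> \<subseteq> \<sigma>" for \<rho>
    using assms(1) \<open>\<sigma> \<in> X\<close> that unfolding abstract_simplicial_complex_def by blast
  then have "?W \<noteq> {}"
    using \<open>U \<notin> X\<close> by auto
  then have W: "card ?W > 0" "card ?W \<le> card U"
    using \<open>finite U\<close> by (auto simp: card_gt_0_iff intro: card_mono)
  define y where "y = (\<lambda>u. if u \<in> ?W then 1 / real (card ?W) else 0)"
  have "(\<Sum>i\<le>?d. y (the_inv_into U e i)) = (\<Sum>u\<in>U. y u)"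
    using sum.reindex_bij_betw[OF e, of "\<lambda>i. y (the_inv_into U e i)"] e
    by (simp add: bij_betw_def the_inv_into_f_f)
  also have "\<dots> = (\<Sum>u\<in>?W. 1 / real (card ?W))"
    unfolding y_def using \<open>finite U\<close> by (intro sum.mono_neutral_cong_right) auto
  also have "\<dots> = 1"
    using W by simp
  finally obtain x where x: "\<And>i. i \<ge> ?d \<Longrightarrow> x i = 0"
      "\<And>i. i \<le> ?d \<Longrightarrow> barycentric ?d x i = y (the_inv_into U e i)"
    using barycentric_surj[of "\<lambda>i. y (the_inv_into U e i)" ?d] by blast
  have xe: "barycentric ?d x (e u) = y u" if "u \<in> U" for u
    using x(2)[of "e u"] that e by (auto simp: bij_betw_def the_inv_into_f_f)
  have y0: "0 \<le> y u" for u
    by (simp add: y_def)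
  have "1 / card U \<le> (\<Sum>u\<in>\<tau>. barycentric ?d x (e u))"
    if v: "v \<in> \<sigma>" and \<tau>: "\<tau> \<subseteq> U" "insert v \<tau> \<notin> X" for v \<tau>
  proof -
    \<comment> \<open>All subsets of \<open>\<sigma>\<close> are faces, so
      \<open>insert v \<tau>\<close> leaves \<open>\<sigma>\<close>; as
      \<open>v \<in> \<sigma>\<close>, it does so at a vertex of \<open>\<tau>\<close>. The weight
      of this vertex alone reaches the threshold.\<close>
    obtain u where u: "u \<in> \<tau>" "u \<in> ?W"
      using v \<tau> down[of "insert v \<tau>"] by blast
    have "1 / card U \<le> y u"
      using W u by (simp add: y_def frac_le)
    also have "\<dots> \<le> (\<Sum>u\<in>\<tau>. y u)"
      using u y0 \<tau> \<open>finite U\<close> by (intro member_le_sum) (auto intro: finite_subset)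
    also have "\<dots> = (\<Sum>u\<in>\<tau>. barycentric ?d x (e u))"
      using \<tau> by (intro sum.cong refl xe[symmetric]) blast
    finally show ?thesis .
  qed
  moreover have "x \<in> closed_simplex ?d"
    unfolding closed_simplex_def using x y0 by simp
  moreover have "barycentric ?d x (e v) = 0" if "v \<in> \<sigma>" "v \<in> U" for v
    using xe[OF \<open>v \<in> U\<close>] \<open>v \<in> \<sigma>\<close> by (simp add: y_def)
  ultimately have "x \<in> (\<Inter>v\<in>\<sigma>. vertex_body X U e v)"
    unfolding vertex_body_def by blast
  then show ?thesis
    by blast
qed

lemma face_if_vertex_bodies_meet:
  assumes X: "abstract_simplicial_complex V X" and "finite V" "U \<subseteq> V" "U \<notin> X"
    and missing: "\<And>\<tau>. missing_face V X \<tau> \<Longrightarrow> card (\<tau> - U) \<le> 1"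
    and "\<sigma> \<subseteq> V" "(\<Inter>v\<in>\<sigma>. vertex_body X U e v) \<noteq> {}"
  shows "\<sigma> \<in> X"
proof (rule ccontr)
  have "finite U" "finite \<sigma>" "U \<noteq> {}"
    using assms by (auto simp: abstract_simplicial_complex_def intro: finite_subset)
  assume "\<sigma> \<notin> X"
  then obtain \<tau> where \<tau>: "\<tau> \<subseteq> \<sigma>" "missing_face V X \<tau>"
    using subset_missing_face \<open>finite \<sigma>\<close> \<open>\<sigma> \<subseteq> V\<close> by blast
  \<comment> \<open>The bound on missing faces enters here: \<open>v\<close> is the only vertex of
    \<open>\<tau>\<close> outside \<open>U\<close>, or any vertex of \<open>\<tau>\<close> if there
    is none outside.\<close>
  have "\<exists>v\<in>\<tau>. \<tau> - U \<subseteq> {v}"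
  proof (cases "\<tau> \<subseteq> U")
    case True
    moreover have "\<tau> \<noteq> {}"
      using \<tau> X by (auto simp: missing_face_def abstract_simplicial_complex_def)
    ultimately show ?thesis
      by blast
  next
    case False
    have "finite (\<tau> - U)"
      using \<tau> \<open>finite \<sigma>\<close> by (auto intro: finite_subset)
    then have "\<And>v w. v \<in> \<tau> - U \<Longrightarrow> w \<in> \<tau> - U \<Longrightarrow> v = w"
      using missing[OF \<tau>(2)] by (simp add: card_le_Suc0_iff_eq)
    with False show ?thesis
      by blast
  qed
  then obtain v where v: "v \<in> \<tau>" "\<tau> - U \<subseteq> {v}"
    by blast
  obtain x where x: "\<And>v. v \<in> \<sigma> \<Longrightarrow> x \<in> vertex_body X U e v"
    using assms(7) by blast
  let ?Z = "{u \<in> U. barycentric (card U - 1) x (e u) = 0}"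
  have "insert v ?Z \<in> X"
    using v \<tau> x \<open>finite U\<close> \<open>U \<noteq> {}\<close> by (intro vertex_body_zeros) auto
  \<comment> \<open>The body of each vertex in \<open>\<tau> \<inter> U\<close> contains
    \<open>x\<close> and forces the coordinate of that vertex to vanish.\<close>
  moreover have "\<tau> \<inter> U \<subseteq> ?Z"
    using \<tau> x by (auto simp: vertex_body_def)
  with v have "\<tau> \<subseteq> insert v ?Z"
    by blast
  ultimately have "\<tau> \<in> X"
    using X unfolding abstract_simplicial_complex_def by blast
  with \<tau> show False
    by (simp add: missing_face_def)
qed

theorem theorem5p2:
  fixes V U :: "'a set" and X :: "'a set set"
  assumes "finite V"
    and "abstract_simplicial_complex V X"
    and "U \<subseteq> V"
    and "U \<notin> X"
    and "\<And>\<tau>. missing_face V X \<tau> \<Longrightarrow> card (\<tau> - U) \<le> 1"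
  shows "representable (card U - 1) V X"
proof -
  have "finite U" "U \<noteq> {}"
    using assms by (auto simp: abstract_simplicial_complex_def intro: finite_subset)
  \<comment> \<open>The truncated subtraction is harmless: \<open>U\<close> is nonempty because the
    empty set is a face.\<close>
  then have "card U = card {..card U - 1}"
    by (simp add: card_gt_0_iff)
  then obtain e where e: "bij_betw e U {..card U - 1}"
    using \<open>finite U\<close> finite_same_card_bij by blast
  have "\<sigma> \<in> X \<longleftrightarrow> \<sigma> \<in> nerve V (vertex_body X U e)" if "\<sigma> \<subseteq> V" for \<sigma>
  proof
    assume "\<sigma> \<in> X"
    then show "\<sigma> \<in> nerve V (vertex_body X U e)"
      using that vertex_bodies_common_point[OF assms(2) \<open>finite U\<close> \<open>U \<notin> X\<close> e]
      by (simp add: nerve_def)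
  next
    assume "\<sigma> \<in> nerve V (vertex_body X U e)"
    then show "\<sigma> \<in> X"
      unfolding nerve_def
      by (intro face_if_vertex_bodies_meet[OF assms(2,1,3,4,5) that]) auto
  qed
  then have "isomorphic_complexes V X V (nerve V (vertex_body X U e))"
    unfolding isomorphic_complexes_def by (intro exI[of _ id]) auto
  then show ?thesis
    unfolding representable_def
    by (intro exI[of _ "vertex_body X U e"] conjI ballI compactin_vertex_body convex_seqs_vertex_body)
qed

end
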